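(* Every $n\times n$ Latin square $L$ has a greedy defining set of size at most $n^2-\frac{n\log (4n)}{4}$.
   Context: An $n\times n$ Latin square on $\{1,\dots,n\}$ is identified with a proper $n$-coloring of $K_n\Box K_n$ (cell $(i,j)$ colored by its entry), with cells ordered lexicographically: $(i,j)<(i',j')$ iff $i<i'$, or $i=i'$ and $j<j'$. A set $D$ of cells is a greedy defining set of $L$ if, pre-coloring the cells of $D$ with their entries in $L$ and then processing the remaining cells in lexicographic order, giving each the smallest positive integer not already used by a colored cell in the same row or column (cells of $D$ count as colored from the start), produces exactly $L$. Here $\log$ is the natural logarithm. *)

theory Defs
  imports Complex_Main
begin

definition cells :: "nat \<Rightarrow> (nat \<times> nat) set" where
  "cells n = {1..n} \<times> {1..n}"

definition latin_square :: "nat \<Rightarrow> (nat \<times> nat \<Rightarrow> nat) \<Rightarrow> bool" where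
  "latin_square n L \<longleftrightarrow>
     (\<forall>i\<in>{1..n}. bij_betw (\<lambda>j. L (i, j)) {1..n} {1..n}) \<and>
     (\<forall>j\<in>{1..n}. bij_betw (\<lambda>i. L (i, j)) {1..n} {1..n})"

definition lex_cells :: "nat \<Rightarrow> (nat \<times> nat) list" where
  "lex_cells n = List.product [1..<Suc n] [1..<Suc n]"

text \<open>The list \<open>lex_cells n\<close> is the strictly increasing lexicographic enumeration of the cells.
  (The order instance of \<open>Product_Lexorder\<close> is avoided, since it clashes with the componentwise
  order on pairs used by the analysis library.)\<close>

lemma set_lex_cells: "set (lex_cells n) = cells n"
  by (auto simp: lex_cells_def cells_def)

lemma sorted_product:
  fixes xs ys :: "nat list"
  assumes "sorted_wrt (<) xs" "sorted_wrt (<) ys"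
  shows "sorted_wrt (\<lambda>(i, j) (i', j'). i < i' \<or> (i = i' \<and> j < j')) (List.product xs ys)"
  using assms by (induction xs) (auto simp: sorted_wrt_append sorted_wrt_map)

lemma sorted_lex_cells:
  "sorted_wrt (\<lambda>(i, j) (i', j'). i < i' \<or> (i = i' \<and> j < j')) (lex_cells n)"
  unfolding lex_cells_def by (rule sorted_product) (rule sorted_wrt_upt)+

text \<open>Partial colorings send uncolored cells to \<open>None\<close>.\<close>

definition used_colors :: "(nat \<times> nat \<Rightarrow> nat option) \<Rightarrow> nat \<times> nat \<Rightarrow> nat set" where
  "used_colors f c = {k. \<exists>d. (fst d = fst c \<or> snd d = snd c) \<and> f d = Some k}"

definition greedy_step ::
  "nat \<times> nat \<Rightarrow> (nat \<times> nat \<Rightarrow> nat option) \<Rightarrow> (nat \<times> nat \<Rightarrow> nat option)" where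
  "greedy_step c f = f(c := Some (LEAST k. 1 \<le> k \<and> k \<notin> used_colors f c))"

definition precoloring ::
  "(nat \<times> nat \<Rightarrow> nat) \<Rightarrow> (nat \<times> nat) set \<Rightarrow> nat \<times> nat \<Rightarrow> nat option" where
  "precoloring L D c = (if c \<in> D then Some (L c) else None)"

definition greedy_coloring ::
  "nat \<Rightarrow> (nat \<times> nat \<Rightarrow> nat) \<Rightarrow> (nat \<times> nat) set \<Rightarrow> nat \<times> nat \<Rightarrow> nat option" where
  "greedy_coloring n L D = fold greedy_step (filter (\<lambda>c. c \<notin> D) (lex_cells n)) (precoloring L D)"

definition greedy_defining_set ::
  "nat \<Rightarrow> (nat \<times> nat \<Rightarrow> nat) \<Rightarrow> (nat \<times> nat) set \<Rightarrow> bool" where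
  "greedy_defining_set n L D \<longleftrightarrow>
     D \<subseteq> cells n \<and> (\<forall>c\<in>cells n. greedy_coloring n L D c = Some (L c))"

end

theory Submission
  imports Defs
begin

text \<open>Let \<open>S\<close> be the complement of \<open>D\<close>. Call three cells \<open>(i, j)\<close>, \<open>(i, j')\<close>, \<open>(i', j)\<close> with
  \<open>i < i'\<close> and \<open>j < j'\<close> bad if the last two carry the same entry and this entry is smaller than
  \<open>L (i, j)\<close>. The greedy algorithm recovers \<open>L\<close> as soon as \<open>S\<close> contains no bad triple. Since the
  corner of a bad triple carries its largest entry, \<open>S\<close> can be built one entry at a time: from each
  entry take at most \<open>t\<close> cells that are not the corner of a bad triple with the cells taken so far.
  A corner is determined by the unordered pair of its two arms, so at most \<open>card S * (t - 1) / 2\<close>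
  cells are excluded as corners. With \<open>t\<close> close to \<open>sqrt (2 * n)\<close> this gives
  \<open>card S \<ge> n\<^sup>2 / (sqrt (2 * n) + 1)\<close>, which exceeds \<open>n * ln (4 * n) / 4\<close>.\<close>

text \<open>The corner \<open>c\<close> itself may lie outside \<open>S\<close>, so the predicate
  also describes the cells that the construction has to leave out.\<close>

definition blocked :: "(nat \<times> nat \<Rightarrow> nat) \<Rightarrow> (nat \<times> nat) set \<Rightarrow> nat \<times> nat \<Rightarrow> bool" where
  "blocked L S c \<longleftrightarrow> (\<exists>i' j'. fst c < i' \<and> snd c < j' \<and> (fst c, j') \<in> S \<and> (i', snd c) \<in> S \<and>
     L (fst c, j') = L (i', snd c) \<and> L (i', snd c) < L c)"

section \<open>Basic facts on Latin squares\<close>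

lemma latin_square_row_eq:
  assumes "latin_square n L" "(i, j) \<in> cells n" "(i, j') \<in> cells n" "L (i, j) = L (i, j')"
  shows "j = j'"
proof -
  have "inj_on (\<lambda>j. L (i, j)) {1..n}"
    using assms(1,2) by (auto simp: latin_square_def cells_def bij_betw_def)
  then show ?thesis
    using assms(2-4) by (auto simp: cells_def dest: inj_onD)
qed

lemma latin_square_col_eq:
  assumes "latin_square n L" "(i, j) \<in> cells n" "(i', j) \<in> cells n" "L (i, j) = L (i', j)"
  shows "i = i'"
proof -
  have "inj_on (\<lambda>i. L (i, j)) {1..n}"
    using assms(1,2) by (auto simp: latin_square_def cells_def bij_betw_def)
  then show ?thesis
    using assms(2-4) by (auto simp: cells_def dest: inj_onD)
qed

lemma latin_square_entry_in_row:
  assumes "latin_square n L" "i \<in> {1..n}" "x \<in> {1..n}"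
  obtains j where "j \<in> {1..n}" "L (i, j) = x"
  using assms by (metis (no_types, lifting) bij_betw_imp_surj_on image_iff latin_square_def)

lemma latin_square_entry_in_col:
  assumes "latin_square n L" "j \<in> {1..n}" "x \<in> {1..n}"
  obtains i where "i \<in> {1..n}" "L (i, j) = x"
  using assms by (metis (no_types, lifting) bij_betw_imp_surj_on image_iff latin_square_def)

lemma latin_square_range:
  assumes "latin_square n L" "c \<in> cells n"
  shows "L c \<in> {1..n}"
proof (cases c)
  case (Pair i j)
  then have "bij_betw (\<lambda>j. L (i, j)) {1..n} {1..n}" "j \<in> {1..n}"
    using assms by (auto simp: latin_square_def cells_def)
  then show ?thesis
    using Pair bij_betwE by blast
qed

lemma finite_cells: "finite (cells n)"
  by (simp add: cells_def)

lemma card_cells: "card (cells n) = n ^ 2"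
  by (simp add: cells_def power2_eq_square)

section \<open>Correctness of the greedy algorithm\<close>

text \<open>Every entry \<open>y\<close> below \<open>L c\<close> occurs once in the row and once in
  the column of \<open>c\<close>. If \<open>y\<close> were still free at \<open>c\<close>, both
  occurrences would be uncolored, and \<open>arms\<close> would give \<open>L c \<le> y\<close>. The
  entry \<open>L c\<close> itself is free because \<open>L\<close> has no repetition in a row or
  column.\<close>

lemma greedy_step_precoloring:
  assumes L: "latin_square n L" and E: "E \<subseteq> cells n" and c: "c \<in> cells n" "c \<notin> E"
    and arms: "\<And>i' j'. \<lbrakk>(fst c, j') \<in> cells n - E; (i', snd c) \<in> cells n - E;
      L (fst c, j') = L (i', snd c)\<rbrakk> \<Longrightarrow> L c \<le> L (i', snd c)"
  shows "greedy_step c (precoloring L E) = precoloring L (insert c E)"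
proof -
  obtain i j where ij: "c = (i, j)" by (cases c)
  have used: "k \<in> used_colors (precoloring L E) c \<longleftrightarrow> (\<exists>d\<in>E. (fst d = i \<or> snd d = j) \<and> L d = k)"
    for k
    unfolding used_colors_def precoloring_def mem_Collect_eq ij fst_conv snd_conv Bex_def
    by (rule iff_exI) simp
  have range: "L c \<in> {1..n}"
    using latin_square_range[OF L c(1)] .
  have "(LEAST k. 1 \<le> k \<and> k \<notin> used_colors (precoloring L E) c) = L c"
  proof (rule Least_equality)
    have "L c \<notin> used_colors (precoloring L E) c"
    proof
      assume "L c \<in> used_colors (precoloring L E) c"
      then obtain d where "d \<in> E" "fst d = i \<or> snd d = j" "L d = L (i, j)"
        unfolding used unfolding ij by blast
      then obtain a b where ab: "(a, b) \<in> E" "a = i \<or> b = j" "L (a, b) = L (i, j)"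
        by (metis prod.collapse)
      then have "(a, b) = (i, j)"
        using latin_square_row_eq[OF L] latin_square_col_eq[OF L] E c(1) ij by (metis subsetD)
      then show False
        using ab(1) c(2) ij by simp
    qed
    then show "1 \<le> L c \<and> L c \<notin> used_colors (precoloring L E) c"
      using range by simp
  next
    fix y
    assume y: "1 \<le> y \<and> y \<notin> used_colors (precoloring L E) c"
    show "L c \<le> y"
    proof (rule ccontr)
      assume less: "\<not> L c \<le> y"
      then have yn: "y \<in> {1..n}" using y range by auto
      have i: "i \<in> {1..n}" and j: "j \<in> {1..n}" using c(1) by (auto simp: ij cells_def)
      obtain j' where j': "j' \<in> {1..n}" "L (i, j') = y"
        using latin_square_entry_in_row[OF L i yn] .
      obtain i' where i': "i' \<in> {1..n}" "L (i', j) = y"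
        using latin_square_entry_in_col[OF L j yn] .
      have "(i, j') \<in> cells n - E" "(i', j) \<in> cells n - E"
        using i j i' j' y by (auto simp: cells_def used)
      then show False
        using arms[of j' i'] i' j' less by (simp add: ij)
    qed
  qed
  then show ?thesis
    by (auto simp: greedy_step_def precoloring_def fun_eq_iff)
qed

lemma greedy_defining_set_if_not_blocked:
  assumes L: "latin_square n L" and S: "S \<subseteq> cells n"
    and nb: "\<And>c. c \<in> S \<Longrightarrow> \<not> blocked L S c"
  shows "greedy_defining_set n L (cells n - S)"
proof -
  let ?D = "cells n - S"
  define zs where "zs = filter (\<lambda>c. c \<notin> ?D) (lex_cells n)"
  have set_zs: "set zs = S"
    using S by (auto simp: zs_def set_lex_cells)
  have sorted_zs: "sorted_wrt (\<lambda>(i, j) (i', j'). i < i' \<or> (i = i' \<and> j < j')) zs"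
    unfolding zs_def by (rule sorted_wrt_filter) (rule sorted_lex_cells)
  \<comment> \<open>Invariant of the run: the cells processed so far have received their entries in
    \<open>L\<close>, so the state is again a precoloring.\<close>
  have prefix: "fold greedy_step xs (precoloring L ?D) = precoloring L (?D \<union> set xs)"
    if "zs = xs @ ys" for xs ys
    using that
  proof (induction xs arbitrary: ys rule: rev_induct)
    case Nil
    then show ?case by simp
  next
    case (snoc c xs)
    have IH: "fold greedy_step xs (precoloring L ?D) = precoloring L (?D \<union> set xs)"
      using snoc by simp
    have later: "d = c \<or> (fst c < fst d \<or> fst c = fst d \<and> snd c < snd d)"
      if "d \<in> cells n - (?D \<union> set xs)" for d
    proof -
      have "d \<in> set zs" "d \<notin> set xs" using that set_zs by auto
      then show ?thesis
        using sorted_zs snoc.prems by (auto simp: sorted_wrt_append)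
    qed
    have cS: "c \<in> S" using set_zs snoc.prems by auto
    have "c \<notin> set xs"
      using sorted_zs snoc.prems by (auto simp: sorted_wrt_append)
    moreover have "L c \<le> L (i', snd c)"
      if a: "(fst c, j') \<in> cells n - (?D \<union> set xs)" "(i', snd c) \<in> cells n - (?D \<union> set xs)"
        "L (fst c, j') = L (i', snd c)" for i' j'
    proof (rule ccontr)
      assume less: "\<not> L c \<le> L (i', snd c)"
      have "(fst c, j') \<noteq> c" "(i', snd c) \<noteq> c" using less a(3) by auto
      \<comment> \<open>An uncolored cell other than \<open>c\<close> comes later, hence to the
        right of \<open>c\<close> if in its row and below \<open>c\<close> if in its column: exactly
        the shape of a bad triple.\<close>
      then have "snd c < j'" "fst c < i'"
        using later[OF a(1)] later[OF a(2)] by auto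
      then have "blocked L S c"
        using a less unfolding blocked_def by (intro exI[of _ i'] exI[of _ j']) auto
      then show False using nb cS by blast
    qed
    moreover have "set xs \<subseteq> S" using set_zs snoc.prems by auto
    ultimately have "greedy_step c (precoloring L (?D \<union> set xs)) =
        precoloring L (insert c (?D \<union> set xs))"
      using cS S by (intro greedy_step_precoloring[OF L]) auto
    then show ?case by (simp add: IH)
  qed
  have "greedy_coloring n L ?D = precoloring L (cells n)"
    using prefix[of zs "[]"] S
    unfolding greedy_coloring_def zs_def[symmetric] by (simp add: set_zs Un_absorb2)
  then show ?thesis
    by (simp add: greedy_defining_set_def precoloring_def)
qed

section \<open>Building the set entry by entry\<close>

text \<open>Induction on the largest entry treated. The last conjunct records maximality: a cell is
  left out only if it is blocked or its entry has reached the quota \<open>t\<close>.\<close>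

lemma exists_unblocked_set:
  "\<exists>S. S \<subseteq> {c \<in> cells n. L c \<le> m} \<and> (\<forall>c\<in>S. \<not> blocked L S c) \<and>
     (\<forall>x. card {c \<in> S. L c = x} \<le> t) \<and>
     (\<forall>c\<in>cells n - S. L c \<le> m \<longrightarrow> blocked L S c \<or> card {d \<in> S. L d = L c} = t)"
proof (induction m)
  case 0
  \<comment> \<open>Here \<open>L\<close> is arbitrary, so entry 0 may occur; such a cell is never
    blocked, as arms carry a smaller entry.\<close>
  define F where "F = {c \<in> cells n. L c = 0}"
  obtain T where T: "T \<subseteq> F" "card T = min t (card F)"
    using obtain_subset_with_card_n[of "min t (card F)" F] by auto
  have finF: "finite F" by (simp add: F_def finite_cells)
  have L0: "L c = 0" if "c \<in> T" for c using T that by (auto simp: F_def)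
  have "{c \<in> T. L c = x} = (if x = 0 then T else {})" for x
    using L0 by auto
  moreover have "card T = t" if "c \<in> F - T" for c
    using that T finF by (metis DiffD1 DiffD2 card_subset_eq min_def)
  ultimately show ?case
    using T L0 by (intro exI[of _ T]) (auto simp: F_def blocked_def)
next
  case (Suc m)
  then obtain S where S: "S \<subseteq> {c \<in> cells n. L c \<le> m}" "\<forall>c\<in>S. \<not> blocked L S c"
      "\<forall>x. card {c \<in> S. L c = x} \<le> t"
      "\<forall>c\<in>cells n - S. L c \<le> m \<longrightarrow> blocked L S c \<or> card {d \<in> S. L d = L c} = t"
    by blast
  define F where "F = {c \<in> cells n. L c = Suc m \<and> \<not> blocked L S c}"
  obtain T where T: "T \<subseteq> F" "card T = min t (card F)"
    using obtain_subset_with_card_n[of "min t (card F)" F] by auto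
  have finF: "finite F" by (simp add: F_def finite_cells)
  have LT: "L c = Suc m" if "c \<in> T" for c using T that by (auto simp: F_def)
  have full: "card T = t" if "c \<in> F - T" for c
    using that T finF by (metis DiffD1 DiffD2 card_subset_eq min_def)
  \<comment> \<open>Arms carry entries strictly below that of the corner, so cells of
    \<open>T\<close> cannot serve as arms here. Later choices thus never spoil earlier ones.\<close>
  have blocked_Un: "blocked L (S \<union> T) c \<longleftrightarrow> blocked L S c" if "L c \<le> Suc m" for c
    using that LT unfolding blocked_def by (metis Un_iff leD)
  have color: "{c \<in> S \<union> T. L c = x} = (if x = Suc m then T else {c \<in> S. L c = x})" for x
    using S(1) LT by auto
  show ?case
  proof (intro exI[of _ "S \<union> T"] conjI ballI allI impI)
    show "S \<union> T \<subseteq> {c \<in> cells n. L c \<le> Suc m}"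
      using S(1) T(1) by (auto simp: F_def)
    show "\<not> blocked L (S \<union> T) c" if "c \<in> S \<union> T" for c
      using that S(1,2) T(1) blocked_Un[of c] by (auto simp: F_def)
    show "card {c \<in> S \<union> T. L c = x} \<le> t" for x
      unfolding color using S(3) T(2) by simp
    show "blocked L (S \<union> T) c \<or> card {d \<in> S \<union> T. L d = L c} = t"
      if "c \<in> cells n - (S \<union> T)" "L c \<le> Suc m" for c
    proof (cases "L c = Suc m")
      case True
      then show ?thesis
        unfolding color using that full[of c] blocked_Un[of c] by (auto simp: F_def)
    next
      case False
      then show ?thesis
        unfolding color using that S(4) blocked_Un[of c] by auto
    qed
  qed
qed

section \<open>Counting\<close>

lemma card_by_color:
  assumes "latin_square n L" "A \<subseteq> cells n"
  shows "card A = (\<Sum>x\<in>{1..n}. card {c \<in> A. L c = x})"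
proof -
  have "finite A" using assms(2) finite_cells finite_subset by blast
  moreover have "A = (\<Union>x\<in>{1..n}. {c \<in> A. L c = x})"
    using latin_square_range[OF assms(1)] assms(2) by auto
  ultimately show ?thesis
    by (subst (1) \<open>A = _\<close>, subst card_UN_disjoint) auto
qed

text \<open>The coordinatewise minimum of the two arms is their corner, so blocked cells are at most
  as many as the unordered pairs of equal entries in \<open>S\<close>. An entry with
  \<open>s \<le> t\<close> cells contributes \<open>s * (s - 1) / 2\<close> pairs.\<close>

lemma card_blocked:
  assumes L: "latin_square n L" and S: "S \<subseteq> cells n"
    and small: "\<And>x. card {c \<in> S. L c = x} \<le> t"
  shows "2 * card {c \<in> cells n. blocked L S c} \<le> card S * (t - 1)"
proof -
  define C where "C x = {c \<in> S. L c = x}" for x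
  define P where "P x = {X. X \<subseteq> C x \<and> card X = 2}" for x
  let ?corner = "\<lambda>X :: (nat \<times> nat) set. (Min (fst ` X), Min (snd ` X))"
  have finC: "finite (C x)" for x
    using S finite_cells finite_subset unfolding C_def by fastforce
  have finP: "finite (P x)" for x
    using finC[of x] by (simp add: P_def)
  have "{c \<in> cells n. blocked L S c} \<subseteq> ?corner ` (\<Union>x\<in>{1..n}. P x)"
  proof
    fix c assume "c \<in> {c \<in> cells n. blocked L S c}"
    then obtain i' j' where *: "fst c < i'" "snd c < j'" "(fst c, j') \<in> S" "(i', snd c) \<in> S"
        "L (fst c, j') = L (i', snd c)"
      by (auto simp: blocked_def)
    let ?X = "{(fst c, j'), (i', snd c)}"
    have "?X \<in> P (L (fst c, j'))" using * by (simp add: P_def C_def)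
    moreover have "L (fst c, j') \<in> {1..n}"
      using latin_square_range[OF L] * S by blast
    moreover have "c = ?corner ?X" using * by (simp add: min_def)
    ultimately show "c \<in> ?corner ` (\<Union>x\<in>{1..n}. P x)" by blast
  qed
  then have "card {c \<in> cells n. blocked L S c} \<le> card (?corner ` (\<Union>x\<in>{1..n}. P x))"
    using finP by (intro card_mono) auto
  also have "\<dots> \<le> card (\<Union>x\<in>{1..n}. P x)"
    using finP by (intro card_image_le) auto
  also have "\<dots> \<le> (\<Sum>x\<in>{1..n}. card (P x))"
    by (intro card_UN_le) auto
  also have "\<dots> = (\<Sum>x\<in>{1..n}. card (C x) choose 2)"
    unfolding P_def using finC by (simp add: n_subsets)
  finally have "2 * card {c \<in> cells n. blocked L S c} \<le> (\<Sum>x\<in>{1..n}. 2 * (card (C x) choose 2))"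
    by (simp add: sum_distrib_left[symmetric])
  also have "\<dots> \<le> (\<Sum>x\<in>{1..n}. card (C x) * (t - 1))"
  proof (rule sum_mono)
    fix x
    have "2 * (card (C x) choose 2) = card (C x) * (card (C x) - 1)"
      unfolding choose_two by (intro dvd_mult_div_cancel) auto
    also have "\<dots> \<le> card (C x) * (t - 1)"
      using small[of x] by (intro mult_le_mono diff_le_mono) (simp_all add: C_def)
    finally show "2 * (card (C x) choose 2) \<le> card (C x) * (t - 1)" .
  qed
  also have "\<dots> = card S * (t - 1)"
    using card_by_color[OF L S] by (simp add: C_def sum_distrib_right)
  finally show ?thesis .
qed

lemma exists_large_unblocked_set:
  assumes L: "latin_square n L" and t: "t \<ge> 1"
  obtains S where "S \<subseteq> cells n" "\<And>c. c \<in> S \<Longrightarrow> \<not> blocked L S c"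
    "2 * n ^ 2 * t \<le> card S * (t ^ 2 + t + 2 * n)"
proof -
  obtain S where S: "S \<subseteq> cells n" "\<forall>c\<in>S. \<not> blocked L S c"
      "\<And>x. card {c \<in> S. L c = x} \<le> t"
      "\<And>c. c \<in> cells n - S \<Longrightarrow> blocked L S c \<or> card {d \<in> S. L d = L c} = t"
    using exists_unblocked_set[of n L n t] latin_square_range[OF L] by fastforce
  define B where "B = {c \<in> cells n. blocked L S c}"
  define s where "s x = card {c \<in> S. L c = x}" for x
  define b where "b x = card {c \<in> B. L c = x}" for x
  have finS: "finite S" and finB: "finite B"
    using S(1) finite_cells finite_subset by (auto simp: B_def)
  \<comment> \<open>One linear inequality covers both cases: the term \<open>s x * n\<close>
    suffices if the quota is reached, and \<open>(s x + b x) * t\<close> suffices otherwise.\<close>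
  have color: "n * t \<le> s x * (t + n) + b x * t" if x: "x \<in> {1..n}" for x
  proof (cases "s x = t")
    case True
    then show ?thesis by (simp add: algebra_simps)
  next
    case False
    \<comment> \<open>Below the quota, every occurrence of \<open>x\<close> is chosen or blocked,
      and each row has one.\<close>
    have "{1..n} \<subseteq> fst ` ({c \<in> S. L c = x} \<union> {c \<in> B. L c = x})"
    proof
      fix i assume i: "i \<in> {1..n}"
      obtain j where j: "j \<in> {1..n}" "L (i, j) = x"
        using latin_square_entry_in_row[OF L i x] .
      then have "(i, j) \<in> cells n" using i by (simp add: cells_def)
      then have "(i, j) \<in> S \<or> (i, j) \<in> B"
        using S(4)[of "(i, j)"] False j by (auto simp: s_def B_def)
      then show "i \<in> fst ` ({c \<in> S. L c = x} \<union> {c \<in> B. L c = x})"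
        using j by force
    qed
    then have "n \<le> card ({c \<in> S. L c = x} \<union> {c \<in> B. L c = x})"
      using surj_card_le[of "{c \<in> S. L c = x} \<union> {c \<in> B. L c = x}" "{1..n}" fst] finS finB by simp
    also have "\<dots> \<le> s x + b x"
      unfolding s_def b_def by (rule card_Un_le)
    finally have "n * t \<le> (s x + b x) * t" by simp
    then show ?thesis by (simp add: algebra_simps)
  qed
  have "n ^ 2 * t = (\<Sum>x\<in>{1..n}. n * t)"
    by (simp add: power2_eq_square)
  also have "\<dots> \<le> (\<Sum>x\<in>{1..n}. s x * (t + n) + b x * t)"
    using color by (rule sum_mono)
  also have "\<dots> = card S * (t + n) + card B * t"
    using card_by_color[OF L S(1)] card_by_color[OF L, of B]
    by (simp add: s_def b_def B_def sum.distrib sum_distrib_right)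
  finally have "2 * n ^ 2 * t \<le> 2 * card S * (t + n) + (2 * card B) * t"
    by simp
  also have "\<dots> \<le> 2 * card S * (t + n) + (card S * (t - 1)) * t"
    using card_blocked[OF L S(1,3)] by (intro add_mono mult_right_mono) (simp_all add: B_def)
  also have "\<dots> = card S * (t ^ 2 + t + 2 * n)"
  proof -
    \<comment> \<open>This removes the truncated subtraction in
      \<open>2 * (t + n) + (t - 1) * t = t ^ 2 + t + 2 * n\<close>.\<close>
    obtain u where "t = Suc u" using t by (cases t) auto
    then show ?thesis by (simp add: algebra_simps power2_eq_square)
  qed
  finally show ?thesis using that S(1,2) by blast
qed

section \<open>Numerical estimate and choice of \<open>t\<close>\<close>

text \<open>With \<open>s = sqrt x\<close>, the logarithm is at most \<open>8 / 5 * s\<close> and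
  the other factor at most \<open>5 / 2 * s\<close>; the constants multiply to exactly 4.\<close>

lemma ln_four_mult_le:
  fixes x :: real
  assumes "x \<ge> 1"
  shows "(sqrt (2 * x) + 1) * ln (4 * x) / 4 \<le> x"
proof -
  define s where "s = sqrt x"
  have s: "s \<ge> 1" "x = s ^ 2" using assms by (auto simp: s_def)
  have e: "exp 1 \<ge> (5 / 2 :: real)"
    using exp_lower_Taylor_quadratic[of 1] by simp
  \<comment> \<open>Applying \<open>ln z \<le> z - 1\<close> at \<open>z = y / exp 1\<close> gives
    \<open>ln y \<le> y / exp 1\<close>, here with \<open>y = 2 * s\<close>.\<close>
  have "ln (2 * s) = ln (2 * s / exp 1) + 1"
    using s by (simp add: ln_div)
  also have "\<dots> \<le> 2 * s / exp 1"
    using ln_le_minus_one[of "2 * s / exp 1"] s by simp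
  also have "\<dots> \<le> 2 * s / (5 / 2)"
    using e s by (intro divide_left_mono) auto
  finally have ln: "ln (2 * s) \<le> 4 / 5 * s" by simp
  have "ln (4 * x) = ln ((2 * s) ^ 2)" by (simp add: s power2_eq_square)
  also have "\<dots> = 2 * ln (2 * s)" using s by (subst ln_realpow) auto
  finally have ln4: "ln (4 * x) \<le> 8 / 5 * s" using ln by simp
  have "sqrt 2 \<le> 3 / 2" by (rule real_le_lsqrt) (auto simp: power2_eq_square)
  then have "sqrt (2 * x) + 1 \<le> 3 / 2 * s + s"
    using s by (intro add_mono) (auto simp: real_sqrt_mult)
  then have "(sqrt (2 * x) + 1) * ln (4 * x) \<le> (3 / 2 * s + s) * (8 / 5 * s)"
    using ln4 assms s(1) by (intro mult_mono) auto
  then show ?thesis by (simp add: s power2_eq_square algebra_simps)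
qed

theorem theorem5:
  fixes n :: nat and L :: "nat \<times> nat \<Rightarrow> nat"
  assumes "n \<ge> 1" and "latin_square n L"
  shows "\<exists>D. greedy_defining_set n L D \<and>
             real (card D) \<le> real n ^ 2 - real n * ln (4 * real n) / 4"
proof -
  define r where "r = sqrt (2 * real n)"
  \<comment> \<open>The bound on \<open>card S\<close> is best where \<open>t + 2 * n / t\<close> is
    least, at the real point \<open>r\<close>.\<close>
  define t where "t = nat \<lceil>r\<rceil>"
  have r: "r > 0" "r ^ 2 = 2 * real n" using assms(1) by (auto simp: r_def)
  have t: "r \<le> real t" "real t \<le> r + 1" "t \<ge> 1"
    unfolding t_def using r(1) by linarith+
  obtain S where S: "S \<subseteq> cells n" "\<And>c. c \<in> S \<Longrightarrow> \<not> blocked L S c"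
      and card: "2 * n ^ 2 * t \<le> card S * (t ^ 2 + t + 2 * n)"
    using exists_large_unblocked_set[OF assms(2) t(3)] by blast
  have "real (2 * n ^ 2 * t) \<le> real (card S * (t ^ 2 + t + 2 * n))"
    using card of_nat_mono by blast
  then have "2 * real n ^ 2 * real t \<le> real (card S) * (real t ^ 2 + real t + r ^ 2)"
    by (simp add: r)
  also have "\<dots> \<le> real (card S) * (2 * (r + 1) * real t)"
  proof (rule mult_left_mono)
    \<comment> \<open>Rounding up puts \<open>t\<close> between the roots \<open>r\<close> and
      \<open>r + 1\<close> of this quadratic, so rounding costs no more than replacing
      \<open>r\<close> by \<open>r + 1\<close>.\<close>
    have "(real t - r) * (real t - r - 1) \<le> 0"
      using t by (intro mult_nonneg_nonpos) auto
    then have "real t ^ 2 + real t + r ^ 2 \<le> 2 * (r + 1) * real t - r"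
      by (simp add: algebra_simps power2_eq_square)
    then show "real t ^ 2 + real t + r ^ 2 \<le> 2 * (r + 1) * real t"
      using r by simp
  qed simp
  finally have "real n ^ 2 * (2 * real t) \<le> (real (card S) * (r + 1)) * (2 * real t)"
    by (simp add: algebra_simps)
  then have "real n ^ 2 \<le> real (card S) * (r + 1)"
    using t(3) by (subst (asm) mult_le_cancel_right_pos) auto
  moreover have "real n * ((r + 1) * ln (4 * real n) / 4) \<le> real n * real n"
    using ln_four_mult_le[of "real n"] assms(1) by (intro mult_left_mono) (auto simp: r_def)
  ultimately have "(real n * ln (4 * real n) / 4) * (r + 1) \<le> real (card S) * (r + 1)"
    by (simp add: power2_eq_square algebra_simps)
  then have large: "real n * ln (4 * real n) / 4 \<le> real (card S)"
    using r(1) by (simp add: mult_le_cancel_right)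
  have "card S \<le> card (cells n)"
    using S(1) finite_cells by (rule card_mono[rotated])
  moreover have "card (cells n - S) = card (cells n) - card S"
    using S(1) finite_cells by (simp add: card_Diff_subset finite_subset)
  ultimately have "real (card (cells n - S)) = real n ^ 2 - real (card S)"
    by (simp add: card_cells of_nat_diff)
  then show ?thesis
    using greedy_defining_set_if_not_blocked[OF assms(2) S] large by fastforce
qed

end
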